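(* Let $n\ge 2$ be an even integer. The characteristic polynomial of the Laplacian matrix of $\Delta(SD_{8n})$ is \[\Phi(L(\Delta(SD_{8n})),x)=x(x-8n)^2(x-4)^{2n}(x-2)^{2n}(x-4n)^{4n-3}.\]
   Context: For an integer $n\ge 2$, the semidihedral group is $SD_{8n}=\langle a,b : a^{4n}=b^2=e,\ ba=a^{2n-1}b\rangle$, a group of order $8n$. The commuting graph $\Delta(G)$ of a group $G$ is the simple graph with vertex set $G$ in which two distinct vertices $x,y$ are adjacent iff $xy=yx$. The Laplacian matrix of a finite graph $\Gamma$ is $L(\Gamma)=D(\Gamma)-A(\Gamma)$, where $A(\Gamma)$ is the adjacency matrix and $D(\Gamma)$ is the diagonal matrix of vertex degrees; $\Phi(L(\Gamma),x)=\det(xI-L(\Gamma))$. *)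

theory Defs
  imports
    "HOL-Algebra.Group"
    "HOL-Algebra.Coset"
    "Jordan_Normal_Form.Char_Poly"
begin

section \<open>Groups given by generators and relations\<close>

datatype 'g letter = Gen 'g | Inv 'g

type_synonym 'g word = "'g letter list"

text \<open>
  The congruence on words generated by the free cancellation rules and by a set of relations
  \<open>R\<close>, where a pair \<open>(u, v)\<close> in \<open>R\<close> stands for the relation \<open>u = v\<close>.
\<close>
inductive pres_eq :: "('g word \<times> 'g word) set \<Rightarrow> 'g word \<Rightarrow> 'g word \<Rightarrow> bool"
  for R :: "('g word \<times> 'g word) set"
where
  pres_rel: "(u, v) \<in> R \<Longrightarrow> pres_eq R u v"
| pres_cancel_right: "pres_eq R [Gen g, Inv g] []"
| pres_cancel_left: "pres_eq R [Inv g, Gen g] []"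
| pres_refl: "pres_eq R u u"
| pres_sym: "pres_eq R u v \<Longrightarrow> pres_eq R v u"
| pres_trans: "pres_eq R u v \<Longrightarrow> pres_eq R v w \<Longrightarrow> pres_eq R u w"
| pres_append: "pres_eq R u u' \<Longrightarrow> pres_eq R v v' \<Longrightarrow> pres_eq R (u @ v) (u' @ v')"

definition pres_class :: "('g word \<times> 'g word) set \<Rightarrow> 'g word \<Rightarrow> 'g word set" where
  "pres_class R u = {v. pres_eq R u v}"

definition presented_group :: "('g word \<times> 'g word) set \<Rightarrow> 'g word set monoid" where
  "presented_group R =
     \<lparr>carrier = range (pres_class R),
      monoid.mult = (\<lambda>X Y. \<Union>u\<in>X. \<Union>v\<in>Y. pres_class R (u @ v)),
      monoid.one = pres_class R []\<rparr>"

lemma pres_class_eq_iff: "pres_class R u = pres_class R v \<longleftrightarrow> pres_eq R u v"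
proof
  assume "pres_class R u = pres_class R v"
  moreover have "v \<in> pres_class R v" by (simp add: pres_class_def pres_refl)
  ultimately have "v \<in> pres_class R u" by simp
  then show "pres_eq R u v" by (simp add: pres_class_def)
next
  assume uv: "pres_eq R u v"
  show "pres_class R u = pres_class R v"
    unfolding pres_class_def using pres_trans[OF uv] pres_trans[OF pres_sym[OF uv]] by blast
qed

lemma presented_group_mult:
  "pres_class R u \<otimes>\<^bsub>presented_group R\<^esub> pres_class R v = pres_class R (u @ v)"
proof -
  have "pres_class R (u' @ v') = pres_class R (u @ v)"
    if "u' \<in> pres_class R u" "v' \<in> pres_class R v" for u' v'
    using that unfolding pres_class_eq_iff by (simp add: pres_class_def pres_append pres_sym)
  then have "(\<Union>u'\<in>pres_class R u. \<Union>v'\<in>pres_class R v. pres_class R (u' @ v')) =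
      (\<Union>u'\<in>pres_class R u. \<Union>v'\<in>pres_class R v. pres_class R (u @ v))"
    by (intro SUP_cong refl) blast
  also have "\<dots> = pres_class R (u @ v)"
    using pres_refl[of R u] pres_refl[of R v] by (auto simp: pres_class_def)
  finally show ?thesis
    unfolding presented_group_def by (simp only: monoid.simps)
qed

fun inv_letter :: "'g letter \<Rightarrow> 'g letter" where
  "inv_letter (Gen g) = Inv g"
| "inv_letter (Inv g) = Gen g"

lemma pres_cancel_letter: "pres_eq R [inv_letter x, x] []"
  by (cases x) (simp_all add: pres_cancel_left pres_cancel_right)

lemma pres_inverse_word: "pres_eq R (rev (map inv_letter u) @ u) []"
proof (induction u)
  case Nil
  show ?case by (simp add: pres_refl)
next
  case (Cons x u)
  have "pres_eq R (rev (map inv_letter u) @ ([inv_letter x, x] @ u)) (rev (map inv_letter u) @ ([] @ u))"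
    by (intro pres_append pres_refl pres_cancel_letter)
  from pres_trans[OF this] Cons show ?case by simp
qed

lemma group_presented_group: "group (presented_group R)"
proof (rule groupI)
  fix x assume "x \<in> carrier (presented_group R)"
  then obtain u where x: "x = pres_class R u" by (auto simp: presented_group_def)
  have one: "\<one>\<^bsub>presented_group R\<^esub> = pres_class R []" by (simp add: presented_group_def)
  show "\<one>\<^bsub>presented_group R\<^esub> \<otimes>\<^bsub>presented_group R\<^esub> x = x"
    by (simp add: one x presented_group_mult)
  show "\<exists>y\<in>carrier (presented_group R). y \<otimes>\<^bsub>presented_group R\<^esub> x = \<one>\<^bsub>presented_group R\<^esub>"
    by (rule bexI[of _ "pres_class R (rev (map inv_letter u))"])
       (auto simp: one x presented_group_mult pres_class_eq_iff pres_inverse_word,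
        simp add: presented_group_def)
next
  show "\<one>\<^bsub>presented_group R\<^esub> \<in> carrier (presented_group R)"
    by (simp add: presented_group_def)
next
  fix x y assume "x \<in> carrier (presented_group R)" "y \<in> carrier (presented_group R)"
  then obtain u v where "x = pres_class R u" "y = pres_class R v"
    by (auto simp: presented_group_def)
  then have "x \<otimes>\<^bsub>presented_group R\<^esub> y = pres_class R (u @ v)" by (simp add: presented_group_mult)
  then show "x \<otimes>\<^bsub>presented_group R\<^esub> y \<in> carrier (presented_group R)"
    by (simp add: presented_group_def)
next
  fix x y z
  assume "x \<in> carrier (presented_group R)" "y \<in> carrier (presented_group R)"
    "z \<in> carrier (presented_group R)"
  then obtain u v w where "x = pres_class R u" "y = pres_class R v" "z = pres_class R w"
    by (auto simp: presented_group_def)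
  then show "x \<otimes>\<^bsub>presented_group R\<^esub> y \<otimes>\<^bsub>presented_group R\<^esub> z =
      x \<otimes>\<^bsub>presented_group R\<^esub> (y \<otimes>\<^bsub>presented_group R\<^esub> z)"
    by (simp add: presented_group_mult)
qed

section \<open>The semidihedral groups\<close>

datatype sd_gen = sd_a | sd_b

definition sd_relations :: "nat \<Rightarrow> (sd_gen word \<times> sd_gen word) set" where
  "sd_relations n =
     {(replicate (4 * n) (Gen sd_a), []),
      ([Gen sd_b, Gen sd_b], []),
      ([Gen sd_b, Gen sd_a], replicate (2 * n - 1) (Gen sd_a) @ [Gen sd_b])}"

text \<open>Note the subscript: \<open>SD n\<close> is the group usually written $SD_{8n}$, of order \<open>8 * n\<close>.\<close>
definition SD :: "nat \<Rightarrow> sd_gen word set monoid" where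
  "SD n = presented_group (sd_relations n)"

lemma group_SD: "group (SD n)"
  unfolding SD_def by (rule group_presented_group)

text \<open>
  The presented group has order \<open>8 * n\<close>: every word is congruent to some $a^i b^j$ with
  \<open>i < 4 * n\<close> and \<open>j < 2\<close>, and these are told apart by their action on pairs \<open>(i, j)\<close> by
  left multiplication.
\<close>

abbreviation sd_nf :: "nat \<Rightarrow> nat \<Rightarrow> sd_gen word" where
  "sd_nf i j \<equiv> replicate i (Gen sd_a) @ replicate j (Gen sd_b)"

lemma sd_rel_a: "pres_eq (sd_relations n) (replicate (4 * n) (Gen sd_a)) []"
  and sd_rel_b: "pres_eq (sd_relations n) [Gen sd_b, Gen sd_b] []"
  and sd_rel_ba: "pres_eq (sd_relations n) [Gen sd_b, Gen sd_a] (replicate (2 * n - 1) (Gen sd_a) @ [Gen sd_b])"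
  by (auto simp: sd_relations_def intro: pres_rel)

lemma pres_Cons: "pres_eq R u v \<Longrightarrow> pres_eq R (x # u) (x # v)"
  using pres_append[OF pres_refl[of R "[x]"], of u v] by simp

lemma pres_append1: "pres_eq R u v \<Longrightarrow> pres_eq R (u @ w) (v @ w)"
  by (intro pres_append pres_refl)

lemma pres_append2: "pres_eq R u v \<Longrightarrow> pres_eq R (w @ u) (w @ v)"
  by (intro pres_append pres_refl)

lemma pres_replicate_mod:
  assumes "pres_eq R (replicate k x) []"
  shows "pres_eq R (replicate i x) (replicate (i mod k) x)"
proof -
  have "pres_eq R (replicate (k * q) x) []" for q
  proof (induction q)
    case (Suc q)
    from pres_append[OF assms Suc] show ?case by (simp add: replicate_add)
  qed (simp add: pres_refl)
  from pres_append1[OF this, of "i div k" "replicate (i mod k) x"]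
  show ?thesis by (simp flip: replicate_add)
qed

lemma pres_inv_letter:
  assumes "pres_eq R (replicate (Suc k) (Gen g)) []"
  shows "pres_eq R [Inv g] (replicate k (Gen g))"
proof (rule pres_trans)
  show "pres_eq R [Inv g] ([Inv g] @ replicate (Suc k) (Gen g))"
    using pres_sym[OF pres_append2[OF assms, of "[Inv g]"]] by simp
  show "pres_eq R ([Inv g] @ replicate (Suc k) (Gen g)) (replicate k (Gen g))"
    using pres_append1[OF pres_cancel_left[of R g], of "replicate k (Gen g)"] by simp
qed

lemma sd_b_a_power:
  "pres_eq (sd_relations n) (Gen sd_b # replicate i (Gen sd_a))
     (replicate ((2 * n - 1) * i) (Gen sd_a) @ [Gen sd_b])"
proof (induction i)
  case (Suc i)
  let ?A = "\<lambda>k. replicate k (Gen sd_a)"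
  have "pres_eq (sd_relations n) ([Gen sd_b, Gen sd_a] @ ?A i)
      ((?A (2 * n - 1) @ [Gen sd_b]) @ ?A i)"
    by (rule pres_append1[OF sd_rel_ba])
  then have "pres_eq (sd_relations n) (Gen sd_b # ?A (Suc i))
      (?A (2 * n - 1) @ (Gen sd_b # ?A i))"
    by simp
  moreover have "pres_eq (sd_relations n) (?A (2 * n - 1) @ (Gen sd_b # ?A i))
      (?A (2 * n - 1) @ (?A ((2 * n - 1) * i) @ [Gen sd_b]))"
    by (rule pres_append2[OF Suc])
  ultimately have "pres_eq (sd_relations n) (Gen sd_b # ?A (Suc i))
      (?A (2 * n - 1) @ (?A ((2 * n - 1) * i) @ [Gen sd_b]))"
    by (rule pres_trans)
  moreover have "?A (2 * n - 1) @ (?A ((2 * n - 1) * i) @ [Gen sd_b]) =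
      ?A ((2 * n - 1) * Suc i) @ [Gen sd_b]"
    by (simp add: replicate_add)
  ultimately show ?case by (simp only:)
qed (simp add: pres_refl)

lemma sd_word_nf: 
  assumes "n \<ge> 1"
  shows "\<exists>i<4 * n. \<exists>j<2. pres_eq (sd_relations n) w (sd_nf i j)"
proof -
  let ?eq = "pres_eq (sd_relations n)"
  have ga: "\<exists>i j. ?eq (Gen sd_a # sd_nf k l) (sd_nf i j)" for k l
    by (rule exI[of _ "Suc k"], rule exI[of _ l]) (simp add: pres_refl)
  have gb: "\<exists>i j. ?eq (Gen sd_b # sd_nf k l) (sd_nf i j)" for k l
    by (rule exI[of _ "(2 * n - 1) * k"], rule exI[of _ "Suc l"])
       (use pres_append1[OF sd_b_a_power[of n k], of "replicate l (Gen sd_b)"] in simp)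
  have ia: "?eq [Inv sd_a] (replicate (4 * n - 1) (Gen sd_a))"
    by (rule pres_inv_letter) (use sd_rel_a[of n] assms in simp)
  have ib: "?eq [Inv sd_b] [Gen sd_b]"
    using pres_inv_letter[of "sd_relations n" 1 sd_b] sd_rel_b[of n] by simp
  have "\<exists>i j. ?eq w (sd_nf i j)"
  proof (induction w)
    case Nil
    show ?case by (rule exI[of _ 0], rule exI[of _ 0]) (simp add: pres_refl)
  next
    case (Cons x w)
    then obtain k l where "?eq w (sd_nf k l)" by blast
    then have *: "?eq (x # w) (x # sd_nf k l)" by (rule pres_Cons)
    have "\<exists>i j. ?eq (x # sd_nf k l) (sd_nf i j)"
    proof (cases x)
      case (Gen g)
      then show ?thesis using ga gb by (cases g) auto
    next
      case (Inv g)
      show ?thesis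
      proof (cases g)
        case sd_a
        have "?eq ([Inv sd_a] @ sd_nf k l) (replicate (4 * n - 1) (Gen sd_a) @ sd_nf k l)"
          by (rule pres_append1[OF ia])
        then have "?eq (x # sd_nf k l) (sd_nf (4 * n - 1 + k) l)"
          using Inv sd_a by (simp add: replicate_add)
        then show ?thesis by blast
      next
        case sd_b
        have "?eq (x # sd_nf k l) (Gen sd_b # sd_nf k l)"
          using pres_append1[OF ib, of "sd_nf k l"] Inv sd_b by simp
        moreover obtain i j where "?eq (Gen sd_b # sd_nf k l) (sd_nf i j)" using gb by blast
        ultimately have "?eq (x # sd_nf k l) (sd_nf i j)" by (rule pres_trans)
        then show ?thesis by blast
      qed
    qed
    then obtain i j where "?eq (x # sd_nf k l) (sd_nf i j)" by blast
    with * have "?eq (x # w) (sd_nf i j)" by (rule pres_trans)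
    then show ?case by blast
  qed
  then obtain i j where "?eq w (sd_nf i j)" by blast
  moreover have "?eq (sd_nf i j) (sd_nf (i mod (4 * n)) (j mod 2))"
    using sd_rel_a[of n] sd_rel_b[of n]
    by (intro pres_append pres_replicate_mod) (auto simp: numeral_2_eq_2)
  ultimately have "?eq w (sd_nf (i mod (4 * n)) (j mod 2))" by (rule pres_trans)
  moreover have "i mod (4 * n) < 4 * n" "j mod 2 < 2" using assms by auto
  ultimately show ?thesis by blast
qed

fun sd_act :: "nat \<Rightarrow> sd_gen letter \<Rightarrow> int \<times> bool \<Rightarrow> int \<times> bool" where
  "sd_act n (Gen sd_a) (i, s) = ((i + 1) mod (4 * int n), s)"
| "sd_act n (Inv sd_a) (i, s) = ((i - 1) mod (4 * int n), s)"
| "sd_act n (Gen sd_b) (i, s) = (((2 * int n - 1) * i) mod (4 * int n), \<not> s)"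
| "sd_act n (Inv sd_b) (i, s) = (((2 * int n - 1) * i) mod (4 * int n), \<not> s)"

abbreviation sd_acts :: "nat \<Rightarrow> sd_gen word \<Rightarrow> int \<times> bool \<Rightarrow> int \<times> bool" where
  "sd_acts n w \<equiv> foldr (sd_act n) w"

lemma sd_acts_range:
  assumes "n \<ge> 1" "s \<in> {0..<4 * int n} \<times> UNIV"
  shows "sd_acts n w s \<in> {0..<4 * int n} \<times> UNIV"
proof (induction w)
  case (Cons x w)
  then show ?case
    using assms(1) by (cases "(n, x, sd_acts n w s)" rule: sd_act.cases) auto
qed (use assms in simp)

lemma sd_acts_replicate_a:
  assumes "i \<in> {0..<4 * int n}"
  shows "sd_acts n (replicate k (Gen sd_a)) (i, s) = ((i + int k) mod (4 * int n), s)"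
proof (induction k)
  case (Suc k)
  then show ?case by (simp add: mod_add_left_eq add.assoc add.commute[of 1] del: foldr_replicate)
qed (use assms in simp)

lemma sd_twist_involution: "((2 * m - 1) * ((2 * m - 1) * i mod (4 * m))) mod (4 * m) = i mod (4 * m)"
  for m i :: int
proof -
  have "((2 * m - 1) * ((2 * m - 1) * i mod (4 * m))) mod (4 * m) = ((2 * m - 1) * ((2 * m - 1) * i)) mod (4 * m)"
    by (simp add: mod_mult_right_eq)
  also have "(2 * m - 1) * ((2 * m - 1) * i) = i + 4 * m * ((m - 1) * i)"
    by (simp add: algebra_simps)
  finally show ?thesis by simp
qed

lemma sd_acts_cong:
  assumes "n \<ge> 1" "pres_eq (sd_relations n) u v" "s \<in> {0..<4 * int n} \<times> UNIV"
  shows "sd_acts n u s = sd_acts n v s"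
  using assms(2,3)
proof (induction arbitrary: s)
  case (pres_rel u v)
  obtain i t where s: "s = (i, t)" by fastforce
  with pres_rel have i: "i \<in> {0..<4 * int n}" by auto
  have m1: "int (2 * n - 1) = 2 * int n - 1" using assms(1) by auto
  have "(2 * int n - 1) * ((i + 1) mod (4 * int n)) mod (4 * int n) =
     ((2 * int n - 1) * i mod (4 * int n) + (2 * int n - 1)) mod (4 * int n)"
  proof -
    have "(2 * int n - 1) * ((i + 1) mod (4 * int n)) mod (4 * int n) =
      ((2 * int n - 1) * (i + 1)) mod (4 * int n)"
      by (rule mod_mult_right_eq)
    also have "(2 * int n - 1) * (i + 1) = (2 * int n - 1) * i + (2 * int n - 1)"
      by (simp add: algebra_simps)
    finally show ?thesis by (simp only: mod_add_left_eq)
  qed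
  moreover have "(2 * int n - 1) * i mod (4 * int n) \<in> {0..<4 * int n}"
    using assms(1) by auto
  ultimately show ?case
    using pres_rel(1) i sd_twist_involution[of "int n" i]
    unfolding sd_relations_def s by (auto simp: sd_acts_replicate_a m1 simp del: foldr_replicate)
next
  case (pres_cancel_right g)
  then show ?case
    by (cases s; cases g) (auto simp: sd_twist_involution mod_add_left_eq)
next
  case (pres_cancel_left g)
  then show ?case
    by (cases s; cases g) (auto simp: sd_twist_involution mod_diff_left_eq)
next
  case (pres_append u u' v v')
  then show ?case
    using sd_acts_range[OF assms(1)] by simp
qed auto

lemma sd_nf_inj:
  assumes "n \<ge> 1" "i < 4 * n" "j < 2" "i' < 4 * n" "j' < 2"
    and "pres_eq (sd_relations n) (sd_nf i j) (sd_nf i' j')"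
  shows "i = i' \<and> j = j'"
proof -
  have *: "sd_acts n (sd_nf k l) (0, False) = (int k, l = 1)" if "k < 4 * n" "l < 2" for k l
  proof -
    have "l = 0 \<or> l = 1" using that(2) by auto
    then have "sd_acts n (replicate l (Gen sd_b)) (0, False) = (0, l = 1)" by auto
    with that(1) show ?thesis by (simp add: sd_acts_replicate_a del: foldr_replicate)
  qed
  have "sd_acts n (sd_nf i j) (0, False) = sd_acts n (sd_nf i' j') (0, False)"
    by (rule sd_acts_cong) (use assms in auto)
  with assms show ?thesis by (simp only: * prod.inject) auto
qed

lemma card_SD:
  assumes "n \<ge> 1"
  shows "card (carrier (SD n)) = 8 * n"
proof -
  let ?f = "\<lambda>(i, j). pres_class (sd_relations n) (sd_nf i j)"
  have "bij_betw ?f ({..<4 * n} \<times> {..<2}) (carrier (SD n))"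
    unfolding bij_betw_def
  proof
    show "inj_on ?f ({..<4 * n} \<times> {..<2})"
      using sd_nf_inj[OF assms] by (auto simp: inj_on_def pres_class_eq_iff)
    have "pres_class (sd_relations n) w \<in> ?f ` ({..<4 * n} \<times> {..<2})" for w
    proof -
      obtain i j where "i < 4 * n" "j < 2" "pres_eq (sd_relations n) w (sd_nf i j)"
        using sd_word_nf[OF assms] by blast
      then show ?thesis by (intro image_eqI[of _ _ "(i, j)"]) (auto simp: pres_class_eq_iff)
    qed
    then show "?f ` ({..<4 * n} \<times> {..<2}) = carrier (SD n)"
      by (auto simp: SD_def presented_group_def)
  qed
  from bij_betw_same_card[OF this] show ?thesis by simp
qed

lemma finite_SD: "n \<ge> 1 \<Longrightarrow> finite (carrier (SD n))"
  by (rule card_ge_0_finite) (simp add: card_SD)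

section \<open>Commuting graphs and Laplacian matrices\<close>

text \<open>A simple graph is a vertex set together with a set of two-element sets of vertices.\<close>
type_synonym 'v sgraph = "'v set \<times> 'v set set"

definition commuting_graph :: "('a, 'm) monoid_scheme \<Rightarrow> 'a sgraph" where
  "commuting_graph G =
     (carrier G,
      {{x, y} | x y. x \<in> carrier G \<and> y \<in> carrier G \<and> x \<noteq> y \<and> x \<otimes>\<^bsub>G\<^esub> y = y \<otimes>\<^bsub>G\<^esub> x})"

definition vertex_degree :: "'v sgraph \<Rightarrow> 'v \<Rightarrow> nat" where
  "vertex_degree \<Gamma> v = card {e \<in> snd \<Gamma>. v \<in> e}"

text \<open>
  Matrices indexed by the vertices are taken with respect to an enumeration \<open>vs\<close> of the vertex set,
  that is, a distinct list with \<open>set vs = fst \<Gamma>\<close>.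
\<close>
definition adjacency_mat :: "'v sgraph \<Rightarrow> 'v list \<Rightarrow> real mat" where
  "adjacency_mat \<Gamma> vs =
     mat (length vs) (length vs) (\<lambda>(i, j). if {vs ! i, vs ! j} \<in> snd \<Gamma> then 1 else 0)"

definition degree_mat :: "'v sgraph \<Rightarrow> 'v list \<Rightarrow> real mat" where
  "degree_mat \<Gamma> vs =
     mat (length vs) (length vs) (\<lambda>(i, j). if i = j then real (vertex_degree \<Gamma> (vs ! i)) else 0)"

definition laplacian_mat :: "'v sgraph \<Rightarrow> 'v list \<Rightarrow> real mat" where
  "laplacian_mat \<Gamma> vs = degree_mat \<Gamma> vs - adjacency_mat \<Gamma> vs"

end

theory Submission
  imports Defs
begin

text \<open>
  For even \<open>n\<close> the centre is $\{e, a^{2n}\}$, a noncentral power of \<open>a\<close> commutes exactly with the powers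
  of \<open>a\<close>, and $a^i b$ commutes exactly with the centre and $a^i b, a^{i+2n} b$. So the graph is the join
  of $K_2$ with the disjoint union of $K_{4n-2}$ and \<open>2 n\<close> copies of $K_2$. For any such join of a clique
  with a disjoint union of cliques, the Laplacian is triangular in a basis consisting of the
  all-one vector, indicators of cliques and unit vectors, and its eigenvalues are read off the diagonal.
\<close>

section \<open>Triangularisation of matrices indexed by vertices\<close>

text \<open>Entries are given by a function of the vertices themselves, so matrix identities become
  identities of finite sums over vertices, and an ordering enters only through the lists.\<close>

definition rel_mat :: "('v \<Rightarrow> 'w \<Rightarrow> 'a) \<Rightarrow> 'v list \<Rightarrow> 'w list \<Rightarrow> 'a mat" where
  "rel_mat F vs ws = mat (length vs) (length ws) (\<lambda>(i, j). F (vs ! i) (ws ! j))"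

lemma rel_mat_carrier [simp]: "rel_mat F vs ws \<in> carrier_mat (length vs) (length ws)"
  by (simp add: rel_mat_def)

lemma sum_nth_distinct:
  assumes "distinct vs"
  shows "(\<Sum>k<length vs. f (vs ! k)) = sum f (set vs)"
  using sum.reindex_bij_betw[OF bij_betw_nth[OF assms refl refl], of f] .

lemma sum_delta_mult:
  fixes f :: "'v \<Rightarrow> 'a :: semiring_1"
  assumes "finite S"
  shows "(\<Sum>v\<in>S. of_bool (v = a) * f v) = (if a \<in> S then f a else 0)"
    and "(\<Sum>v\<in>S. of_bool (a = v) * f v) = (if a \<in> S then f a else 0)"
    and "(\<Sum>v\<in>S. f v * of_bool (v = a)) = (if a \<in> S then f a else 0)"
    and "(\<Sum>v\<in>S. f v * of_bool (a = v)) = (if a \<in> S then f a else 0)"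
  using assms by (auto simp: of_bool_def if_distrib if_distribR cong: if_cong)

lemma rel_mat_mult:
  assumes "distinct vs"
  shows "rel_mat F us vs * rel_mat G vs ws = rel_mat (\<lambda>u w. \<Sum>v\<in>set vs. F u v * G v w) us ws"
  by (rule eq_matI)
    (auto simp: rel_mat_def scalar_prod_def atLeast0LessThan simp flip: sum_nth_distinct[OF assms])

lemma rel_mat_eq_one:
  assumes "distinct vs"
  shows "rel_mat (\<lambda>u v. of_bool (u = v)) vs vs = 1\<^sub>m (length vs)"
  using assms by (intro eq_matI) (auto simp: rel_mat_def nth_eq_iff_index_eq)

lemma rel_mat_cong:
  assumes "\<And>u v. u \<in> set us \<Longrightarrow> v \<in> set vs \<Longrightarrow> F u v = G u v"
  shows "rel_mat F us vs = rel_mat G us vs"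
  using assms by (auto simp: rel_mat_def)

section \<open>Characteristic polynomials under change of basis and of enumeration\<close>

lemma char_poly_eq_of_intertwining:
  fixes A :: "'a :: field mat"
  assumes A: "A \<in> carrier_mat n n" and T: "T \<in> carrier_mat n n" and P: "P \<in> carrier_mat n n"
    and det: "det P \<noteq> 0" and AP: "A * P = P * T"
  shows "char_poly A = char_poly T"
proof (rule char_poly_similar)
  from det_non_zero_imp_unit[OF P det, of undefined]
  obtain Q where Q: "Q \<in> carrier_mat n n" "Q * P = 1\<^sub>m n" "P * Q = 1\<^sub>m n"
    by (auto simp: Units_def ring_mat_def)
  have "A = A * (P * Q)" using A Q by simp
  also have "\<dots> = P * T * Q" using A P Q by (simp flip: AP add: assoc_mult_mat)
  finally show "similar_mat A T" using A T P Q by (intro similar_matI[of _ _ P Q n]) auto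
qed

text \<open>The equality matrix between the two enumerations is a permutation matrix, and it
  intertwines the two forms of \<open>F\<close>. Vertices may therefore be reordered or sorted at
  will.\<close>

lemma char_poly_rel_mat_enumeration:
  fixes F :: "'v \<Rightarrow> 'v \<Rightarrow> 'a :: field"
  assumes us: "distinct us" and vs: "distinct vs" and eq: "set us = set vs"
  shows "char_poly (rel_mat F us us) = char_poly (rel_mat F vs vs)"
proof -
  let ?D = "\<lambda>u v. of_bool (u = v) :: 'a"
  have len: "length us = length vs"
    using us vs eq by (metis distinct_card)
  have DD: "rel_mat ?D us vs * rel_mat ?D vs us = 1\<^sub>m (length us)"
    unfolding rel_mat_mult[OF vs] rel_mat_eq_one[OF us, symmetric]
    by (rule rel_mat_cong) (simp add: sum_delta_mult eq)
  have "det (rel_mat ?D us vs) * det (rel_mat ?D vs us) = 1"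
    using det_mult[of "rel_mat ?D us vs" "length us" "rel_mat ?D vs us"]
      rel_mat_carrier[of ?D us vs] rel_mat_carrier[of ?D vs us]
    by (simp only: len DD[unfolded len] det_one)
  then have "det (rel_mat ?D us vs) \<noteq> 0" by auto
  moreover have "rel_mat F us us * rel_mat ?D us vs = rel_mat ?D us vs * rel_mat F vs vs"
    unfolding rel_mat_mult[OF us] rel_mat_mult[OF vs]
    by (rule rel_mat_cong) (simp add: sum_delta_mult eq)
  ultimately show ?thesis
    by (intro char_poly_eq_of_intertwining[of _ "length us" _ "rel_mat ?D us vs"])
      (use rel_mat_carrier[of ?D us vs] rel_mat_carrier[of F us us] in \<open>simp_all add: len\<close>)
qed

text \<open>Sorting the vertices by \<open>stage\<close> makes \<open>P\<close> lower unitriangular,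
  hence invertible, and \<open>T\<close> upper triangular. Distinct vertices of equal stage have
  zero entries in both, so the order among them is arbitrary. The characteristic polynomial is then
  read off the diagonal of \<open>T\<close>.\<close>

lemma char_poly_rel_mat_flag:
  fixes A P T :: "'v \<Rightarrow> 'v \<Rightarrow> 'a :: field" and stage :: "'v \<Rightarrow> nat"
  assumes vs: "distinct vs"
    and P_diag: "\<And>v. v \<in> set vs \<Longrightarrow> P v v = 1"
    and P_low: "\<And>u v. u \<in> set vs \<Longrightarrow> v \<in> set vs \<Longrightarrow> u \<noteq> v \<Longrightarrow> stage u \<le> stage v \<Longrightarrow> P u v = 0"
    and T_up: "\<And>u v. u \<in> set vs \<Longrightarrow> v \<in> set vs \<Longrightarrow> u \<noteq> v \<Longrightarrow> stage v \<le> stage u \<Longrightarrow> T u v = 0"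
    and AP: "\<And>u v. u \<in> set vs \<Longrightarrow> v \<in> set vs \<Longrightarrow>
      (\<Sum>w\<in>set vs. A u w * P w v) = (\<Sum>w\<in>set vs. P u w * T w v)"
  shows "char_poly (rel_mat A vs vs) = (\<Prod>v\<in>set vs. [:- T v v, 1:])"
proof -
  define us where "us = sort_key stage vs"
  have us: "distinct us" "set us = set vs" using vs by (auto simp: us_def)
  have stage: "stage (us ! i) \<le> stage (us ! j)" if "i < j" "j < length us" for i j
    using sorted_nth_mono[of "map stage us" i j] that by (simp add: us_def)
  have neq: "us ! i \<noteq> us ! j" if "i < j" "j < length us" for i j
    using us(1) that by (auto simp: nth_eq_iff_index_eq)
  have mem: "us ! i \<in> set vs" if "i < length us" for i
    using that us(2) by auto
  let ?P = "rel_mat P us us" and ?T = "rel_mat T us us"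
  have "det ?P = prod_list (diag_mat ?P)"
  proof (rule det_lower_triangular)
    fix i j assume "i < j" "j < length us"
    then show "?P $$ (i, j) = 0"
      using P_low stage neq mem by (auto simp: rel_mat_def)
  qed simp
  also have "diag_mat ?P = map (\<lambda>_. 1) [0..<length us]"
    using P_diag mem by (auto simp: diag_mat_def rel_mat_def)
  finally have det: "det ?P \<noteq> 0" by (auto simp: prod_list_zero_iff)
  have "char_poly (rel_mat A vs vs) = char_poly (rel_mat A us us)"
    by (rule char_poly_rel_mat_enumeration) (simp_all add: us vs)
  also have "\<dots> = char_poly ?T"
    by (rule char_poly_eq_of_intertwining[OF rel_mat_carrier rel_mat_carrier rel_mat_carrier det])
      (auto simp: rel_mat_mult us AP intro!: rel_mat_cong)
  also have "\<dots> = (\<Prod>a\<leftarrow>diag_mat ?T. [:- a, 1:])"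
  proof (rule char_poly_upper_triangular)
    show "upper_triangular ?T"
      unfolding upper_triangular_def
    proof (intro allI impI)
      fix i j assume "i < dim_row ?T" "j < i"
      then show "?T $$ (i, j) = 0"
        using T_up[of "us ! i" "us ! j"] stage[of j i] neq[of j i] mem[of i] mem[of j]
        by (simp add: rel_mat_def)
    qed
  qed (rule rel_mat_carrier)
  also have "diag_mat ?T = map (\<lambda>v. T v v) us"
    by (rule nth_equalityI) (auto simp: diag_mat_def rel_mat_def)
  also have "(\<Prod>a\<leftarrow>map (\<lambda>v. T v v) us. [:- a, 1:]) = (\<Prod>v\<in>set vs. [:- T v v, 1:])"
    using prod.distinct_set_conv_list[OF us(1), of "\<lambda>v. [:- T v v, 1:]"]
    by (simp add: us(2) comp_def)
  finally show ?thesis .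
qed

section \<open>Joins of a clique with disjoint cliques\<close>

text \<open>
  The join of a clique on \<open>Z\<close> with a disjoint union of cliques on \<open>V - Z\<close>; two vertices of \<open>V - Z\<close> lie
  in the same clique iff \<open>r\<close> sends them to the same representative. The representative \<open>r0\<close> and
  the vertex \<open>z0\<close> are arbitrary choices.
\<close>
locale joined_cliques =
  fixes V Z :: "'v set" and r :: "'v \<Rightarrow> 'v" and z0 r0 :: 'v
  assumes finite_V: "finite V" and Z_sub: "Z \<subseteq> V" and z0: "z0 \<in> Z"
    and r0: "r0 \<in> V - Z" "r r0 = r0"
    and r_closed: "v \<in> V - Z \<Longrightarrow> r v \<in> V - Z"
    and r_idem: "v \<in> V - Z \<Longrightarrow> r (r v) = r v"
begin

definition block :: "'v \<Rightarrow> 'v set" where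
  "block q = {w \<in> V - Z. r w = q}"

text \<open>Closed neighbourhoods: \<open>u \<in> nbhd u\<close>, which makes the Laplacian \<open>diag |nbhd u| - [v \<in> nbhd u]\<close>.\<close>
definition nbhd :: "'v \<Rightarrow> 'v set" where
  "nbhd u = {v \<in> V. u \<in> Z \<or> v \<in> Z \<or> r u = r v}"

definition lap :: "'v \<Rightarrow> 'v \<Rightarrow> real" where
  "lap u v = of_bool (u = v) * real (card (nbhd u)) - of_bool (v \<in> nbhd u)"

text \<open>The clique of \<open>r0\<close> is left out: the basis vector at \<open>r0\<close> is
  the indicator of all of \<open>V - Z\<close> instead.\<close>

definition reps :: "'v set" where
  "reps = {q \<in> V - Z. r q = q \<and> q \<noteq> r0}"

text \<open>
  The columns of \<open>flag\<close> are the basis vectors: the all-one vector for \<open>z0\<close>, the indicator of \<open>V - Z\<close>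
  for \<open>r0\<close>, the indicators of the other cliques for their representatives, and unit vectors for
  the remaining vertices. The column \<open>tri _ v\<close> expands the image of the basis vector of \<open>v\<close> under
  the Laplacian in this basis; only vectors of smaller \<open>stage\<close> occur besides that of \<open>v\<close>.
\<close>
definition flag :: "'v \<Rightarrow> 'v \<Rightarrow> real" where
  "flag u v = (if v = z0 then 1 else if v = r0 then of_bool (u \<notin> Z)
     else if v \<in> reps then of_bool (u \<in> block v) else of_bool (u = v))"

definition tri :: "'v \<Rightarrow> 'v \<Rightarrow> real" where
  "tri u v =
     (if v = z0 then 0
      else if v \<in> Z then of_bool (u = v) * real (card V) - of_bool (u = z0)
      else if v = r0 then of_bool (u = r0) * real (card V) - of_bool (u = z0) * real (card (V - Z))
      else if v \<in> reps then
        of_bool (u = v) * real (card Z) - of_bool (u = z0) * real (card (block v))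
        + of_bool (u = r0) * real (card (block v))
      else if r v = r0 then
        of_bool (u = v) * real (card (nbhd v)) - of_bool (u = z0) + of_bool (u \<in> reps)
      else of_bool (u = v) * real (card (nbhd v)) - of_bool (u = r v) - of_bool (u = z0)
        + of_bool (u = r0))"

text \<open>On \<open>V\<close>, off-diagonal entries of \<open>flag\<close> occur only in rows of
  higher stage than the column, those of \<open>tri\<close> only in rows of lower stage.\<close>

definition stage :: "'v \<Rightarrow> nat" where
  "stage v = (if v = z0 then 0 else if v \<in> Z then 1 else if v = r0 then 2
     else if v \<in> reps then 3 else 4)"

section \<open>Action of the Laplacian on the basis\<close>

lemma nbhd_central: "u \<in> Z \<Longrightarrow> nbhd u = V"
  by (auto simp: nbhd_def)

lemma nbhd_noncentral: "u \<notin> Z \<Longrightarrow> nbhd u = Z \<union> block (r u)"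
  using Z_sub by (auto simp: nbhd_def block_def)

lemma card_nbhd_noncentral:
  assumes "u \<notin> Z"
  shows "card (nbhd u) = card Z + card (block (r u))"
  unfolding nbhd_noncentral[OF assms]
  by (rule card_Un_disjoint) (auto simp: block_def finite_V intro: finite_subset[OF Z_sub])

text \<open>Row \<open>u\<close> of the Laplacian is its diagonal entry minus the indicator of
  \<open>nbhd u\<close>, so applying it to a set counts the closed neighbours in the set. This
  covers the basis vectors that are indicators.\<close>

lemma lap_indicator:
  assumes u: "u \<in> V"
  shows "(\<Sum>w\<in>V. lap u w * of_bool (w \<in> S)) =
    of_bool (u \<in> S) * real (card (nbhd u)) - real (card (nbhd u \<inter> S))"
proof -
  have "(\<Sum>w\<in>V. lap u w * of_bool (w \<in> S))
      = (\<Sum>w\<in>V. of_bool (u = w) * (real (card (nbhd u)) * of_bool (w \<in> S)))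
        - (\<Sum>w\<in>V. of_bool (w \<in> nbhd u \<inter> S))"
    unfolding sum_subtractf[symmetric]
    by (intro sum.cong) (auto simp: lap_def)
  also have "(\<Sum>w\<in>V. of_bool (w \<in> nbhd u \<inter> S)) = real (card (nbhd u \<inter> S))"
  proof -
    have "(\<Sum>w\<in>V. of_bool (w \<in> nbhd u \<inter> S)) = (\<Sum>w\<in>nbhd u \<inter> S. 1 :: real)"
      using finite_V by (intro sum.mono_neutral_cong_right) (auto simp: nbhd_def)
    then show ?thesis by simp
  qed
  finally show ?thesis using u by (simp add: sum_delta_mult finite_V)
qed

lemma sum_flag:
  assumes "a \<in> V"
  shows "(\<Sum>w\<in>V. flag u w * of_bool (w = a)) = flag u a"
    and "(\<Sum>w\<in>V. flag u w * (of_bool (w = a) * c)) = flag u a * c"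
  using assms by (simp_all add: mult.left_commute[of _ "of_bool _"] sum_delta_mult finite_V)

text \<open>The cliques other than that of \<open>r0\<close> are disjoint, so their indicators add
  up to that of their union. Its complement is the closed neighbourhood of any vertex in the clique
  of \<open>r0\<close>.\<close>

lemma sum_flag_reps:
  assumes "u \<in> V"
  shows "(\<Sum>w\<in>V. flag u w * of_bool (w \<in> reps)) = of_bool (u \<notin> Z \<and> r u \<noteq> r0)"
proof -
  have "(\<Sum>w\<in>V. flag u w * of_bool (w \<in> reps)) =
      (\<Sum>w\<in>V. of_bool (w = r u) * of_bool (u \<notin> Z \<and> r u \<noteq> r0))"
    using assms r_idem[of u] r_closed[of u] z0
    by (intro sum.cong) (auto simp: flag_def reps_def block_def)
  also have "\<dots> = of_bool (u \<notin> Z \<and> r u \<noteq> r0)"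
    using assms r_closed[of u] by (auto simp: sum_delta_mult finite_V)
  finally show ?thesis .
qed

lemma lap_flag:
  assumes u: "u \<in> V" and v: "v \<in> V"
  shows "(\<Sum>w\<in>V. lap u w * flag w v) = (\<Sum>w\<in>V. flag u w * tri w v)"
proof -
  note dist = right_diff_distrib distrib_left sum_subtractf sum.distrib
  have z0V: "z0 \<in> V" and r0V: "r0 \<in> V" and ne: "z0 \<noteq> r0" using z0 Z_sub r0 by auto
  consider "v = z0" | "v \<in> Z" "v \<noteq> z0" | "v = r0" | "v \<in> reps"
    | "v \<notin> Z" "v \<noteq> r0" "v \<notin> reps" by blast
  then show ?thesis
  proof cases
    case 1
    have "(\<Sum>w\<in>V. lap u w * flag w v) = (\<Sum>w\<in>V. lap u w * of_bool (w \<in> V))"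
      by (intro sum.cong) (auto simp: flag_def 1)
    also have "\<dots> = 0"
      using u by (subst lap_indicator[OF u]) (auto simp: nbhd_def Int_absorb2)
    finally show ?thesis by (simp add: tri_def 1)
  next
    \<comment> \<open>A central vertex is adjacent to all others, so its unit vector goes to |V|
      times itself minus the all-one vector.\<close>
    case 2
    then have [simp]: "v \<notin> reps" "v \<noteq> r0" using r0 by (auto simp: reps_def)
    have "(\<Sum>w\<in>V. lap u w * flag w v) = lap u v"
      using 2 v by (simp add: flag_def sum_delta_mult finite_V)
    also have "\<dots> = (\<Sum>w\<in>V. flag u w * tri w v)"
      using 2 u v z0V
      by (simp add: tri_def dist sum_flag) (auto simp: lap_def flag_def nbhd_def)
    finally show ?thesis .
  next
    \<comment> \<open>The image of the indicator of \<open>V - Z\<close> is |V| times itself minus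
      |V - Z| times the all-one vector.\<close>
    case 3
    have "(\<Sum>w\<in>V. lap u w * flag w v) = (\<Sum>w\<in>V. lap u w * of_bool (w \<in> V - Z))"
      using ne by (intro sum.cong) (auto simp: flag_def 3)
    also have "\<dots> = of_bool (u \<in> V - Z) * real (card (nbhd u)) - real (card (nbhd u \<inter> (V - Z)))"
      by (rule lap_indicator[OF u])
    also have "\<dots> = of_bool (u \<notin> Z) * real (card V) - real (card (V - Z))"
    proof (cases "u \<in> Z")
      case True
      then show ?thesis by (simp add: nbhd_central Int_absorb1)
    next
      case False
      have "nbhd u \<inter> (V - Z) = block (r u)" using False by (auto simp: nbhd_noncentral block_def)
      moreover have "card V = card Z + card (V - Z)"
        using finite_V Z_sub by (metis card_Diff_subset card_mono finite_subset le_add_diff_inverse)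
      ultimately show ?thesis using u False by (simp add: card_nbhd_noncentral)
    qed
    also have "\<dots> = (\<Sum>w\<in>V. flag u w * tri w v)"
      using z0V r0V ne r0 by (simp add: tri_def dist sum_flag 3) (simp add: flag_def)
    finally show ?thesis .
  next
    \<comment> \<open>For a clique B the image of its indicator is |Z| times itself minus |B| times
      the indicator of \<open>Z\<close>; the latter is the all-one vector minus the indicator of
      \<open>V - Z\<close>.\<close>
    case 4
    then have [simp]: "v \<notin> Z" "v \<noteq> r0" "v \<noteq> z0" "r v = v" using z0 by (auto simp: reps_def)
    have "(\<Sum>w\<in>V. lap u w * flag w v) = (\<Sum>w\<in>V. lap u w * of_bool (w \<in> block v))"
      using 4 by (simp add: flag_def)
    also have "\<dots> = of_bool (u \<in> block v) * real (card (nbhd u)) - real (card (nbhd u \<inter> block v))"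
      by (rule lap_indicator[OF u])
    also have "\<dots> = of_bool (u \<in> block v) * real (card Z) - of_bool (u \<in> Z) * real (card (block v))"
    proof (cases "u \<in> Z")
      case True
      have "V \<inter> block v = block v" by (auto simp: block_def)
      then show ?thesis using True by (simp add: nbhd_central block_def)
    next
      case False
      have "nbhd u \<inter> block v = (if r u = v then block v else {})"
        using False by (auto simp: nbhd_noncentral block_def)
      moreover have "u \<in> block v \<longleftrightarrow> r u = v" using u False by (simp add: block_def)
      ultimately show ?thesis
        by (cases "r u = v") (simp_all add: card_nbhd_noncentral[OF False] False)
    qed
    also have "\<dots> = (\<Sum>w\<in>V. flag u w * tri w v)"
      using z0V r0V ne r0 v 4 by (simp add: tri_def dist sum_flag) (simp add: flag_def)
    finally show ?thesis .
  next
    case 5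
    then have v': "v \<in> V - Z" "v \<noteq> z0" "r v \<noteq> v" using v z0 by (auto simp: reps_def)
    have rv: "r v \<in> V" "r v \<notin> Z" "r (r v) = r v" using r_closed r_idem v' by auto
    then have rv_reps: "r v \<in> reps" if "r v \<noteq> r0" using that by (auto simp: reps_def)
    have "(\<Sum>w\<in>V. lap u w * flag w v) = lap u v"
      using 5 v v' by (simp add: flag_def sum_delta_mult finite_V)
    also have "\<dots> = of_bool (u = v) * real (card (nbhd v)) - of_bool (u \<in> Z) - of_bool (u \<in> block (r v))"
      using u v' by (auto simp: lap_def nbhd_def block_def)
    also have "\<dots> = (\<Sum>w\<in>V. flag u w * tri w v)"
    \<comment> \<open>The indicators of \<open>Z\<close> and of the clique of \<open>v\<close> must
      be expanded in the basis. For the clique of \<open>r0\<close> their sum is the all-one vector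
      minus the indicators of the other cliques.\<close>
    proof (cases "r v = r0")
      case True
      then show ?thesis
        using 5 u v v' z0V
        by (simp add: tri_def dist sum_flag sum_flag_reps) (auto simp: flag_def block_def)
    next
      case False
      have "r v \<noteq> z0" using rv z0 by auto
      then show ?thesis
        using False 5 u v v' z0V r0V rv rv_reps ne
        by (simp add: tri_def dist sum_flag) (auto simp: flag_def block_def)
    qed
    finally show ?thesis .
  qed
qed

section \<open>Triangularity and the eigenvalues\<close>

lemma flag_strict:
  assumes "u \<in> V" "v \<in> V" "u \<noteq> v" "stage u \<le> stage v"
  shows "flag u v = 0"
proof -
  have "v \<noteq> z0" using assms z0 by (auto simp: stage_def split: if_splits)
  moreover have "u \<in> Z" if "v = r0"
    using assms that r0 z0 by (auto simp: stage_def split: if_splits)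
  moreover have "u \<notin> block v" if "v \<in> reps"
    using assms that r0 z0 by (auto simp: stage_def reps_def block_def split: if_splits)
  ultimately show ?thesis using assms(3) by (simp add: flag_def)
qed

lemma tri_strict:
  assumes "u \<in> V" "v \<in> V" "u \<noteq> v" "stage v \<le> stage u"
  shows "tri u v = 0"
proof -
  have "u = z0 \<Longrightarrow> v = z0" and "u = r0 \<Longrightarrow> v \<in> Z"
    and "u \<in> reps \<Longrightarrow> v \<in> Z \<or> v = r0 \<or> v \<in> reps"
    using assms r0 z0 by (auto simp: stage_def reps_def split: if_splits)
  moreover have "r v = r0 \<or> r v \<in> reps" if "v \<notin> Z"
    using that assms(2) r_closed r_idem by (auto simp: reps_def)
  ultimately show ?thesis
    using assms(3) z0 by (auto simp: tri_def)
qed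

text \<open>The factors come from the diagonal of \<open>tri\<close>. Each clique contributes |Z|
  once, at its representative, except that of \<open>r0\<close>, which contributes |V|
  there.\<close>

lemma char_poly_lap:
  assumes "distinct vs" "set vs = V"
  shows "char_poly (rel_mat lap vs vs) =
    (\<Prod>v\<in>V. [:- (if v = z0 then 0 else if v \<in> Z \<or> v = r0 then real (card V)
       else if r v = v then real (card Z) else real (card Z + card (block (r v)))), 1:])"
    (is "_ = ?rhs")
proof -
  have "char_poly (rel_mat lap vs vs) = (\<Prod>v\<in>V. [:- tri v v, 1:])"
  proof (rule char_poly_rel_mat_flag[where A = lap and P = flag and T = tri and stage = stage
        and vs = vs, unfolded assms(2)])
    show "flag v v = 1" if "v \<in> V" for v
      using that r0 by (auto simp: flag_def reps_def block_def)
    show "flag u v = 0" if "u \<in> V" "v \<in> V" "u \<noteq> v" "stage u \<le> stage v" for u v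
      using that by (rule flag_strict)
    show "tri u v = 0" if "u \<in> V" "v \<in> V" "u \<noteq> v" "stage v \<le> stage u" for u v
      using that by (rule tri_strict)
  qed (simp_all add: assms(1) lap_flag)
  also have "\<dots> = ?rhs"
    using z0 r0 by (intro prod.cong) (auto simp: tri_def reps_def card_nbhd_noncentral)
  finally show ?thesis .
qed

end

section \<open>The commuting graph of the semidihedral group\<close>

text \<open>Edges at \<open>u\<close> correspond to the elements other than \<open>u\<close> that
  commute with \<open>u\<close>; the successor accounts for \<open>u\<close> itself.\<close>

lemma vertex_degree_commuting_graph:
  fixes G (structure)
  assumes "finite (carrier G)" "u \<in> carrier G"
  shows "Suc (vertex_degree (commuting_graph G) u) = card {w \<in> carrier G. u \<otimes> w = w \<otimes> u}"
proof -
  let ?N = "{w \<in> carrier G. u \<otimes> w = w \<otimes> u}"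
  have "{e \<in> snd (commuting_graph G). u \<in> e} = (\<lambda>w. {u, w}) ` (?N - {u})"
    using assms(2) by (auto simp: commuting_graph_def image_iff)
  moreover have "inj_on (\<lambda>w. {u, w}) (?N - {u})"
    by (auto simp: inj_on_def doubleton_eq_iff)
  ultimately have "vertex_degree (commuting_graph G) u = card (?N - {u})"
    by (simp add: vertex_degree_def card_image)
  moreover have "card ?N = Suc (card (?N - {u}))"
    using assms by (intro card.remove) auto
  ultimately show ?thesis by simp
qed

text \<open>Replacing degrees by centralizer sizes adds one on the diagonal, which the subtracted
  term for \<open>u\<close> commuting with itself removes again.\<close>

lemma laplacian_commuting_graph:
  fixes G (structure)
  assumes fin: "finite (carrier G)" and vs: "distinct vs" "set vs = carrier G"
  shows "laplacian_mat (commuting_graph G) vs =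
    rel_mat (\<lambda>u v. of_bool (u = v) * real (card {w \<in> carrier G. u \<otimes> w = w \<otimes> u})
      - of_bool (u \<otimes> v = v \<otimes> u)) vs vs" (is "?L = rel_mat ?F vs vs")
proof (rule eq_matI)
  fix i j
  assume "i < dim_row (rel_mat ?F vs vs)" and "j < dim_col (rel_mat ?F vs vs)"
  then have ij: "i < length vs" "j < length vs" by (simp_all add: rel_mat_def)
  then have mem: "vs ! i \<in> carrier G" "vs ! j \<in> carrier G" by (simp_all flip: vs(2))
  have "?L $$ (i, j) = of_bool (i = j) * real (vertex_degree (commuting_graph G) (vs ! i))
      - of_bool ({vs ! i, vs ! j} \<in> snd (commuting_graph G))"
    using ij by (simp add: laplacian_mat_def degree_mat_def adjacency_mat_def)
  also have "{vs ! i, vs ! j} \<in> snd (commuting_graph G)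
      \<longleftrightarrow> vs ! i \<noteq> vs ! j \<and> vs ! i \<otimes> vs ! j = vs ! j \<otimes> vs ! i"
    using mem by (auto simp: commuting_graph_def doubleton_eq_iff)
  also have "i = j \<longleftrightarrow> vs ! i = vs ! j"
    using vs(1) ij by (simp add: nth_eq_iff_index_eq)
  also have "real (vertex_degree (commuting_graph G) (vs ! i))
      = real (card {w \<in> carrier G. vs ! i \<otimes> w = w \<otimes> vs ! i}) - 1"
    by (simp flip: vertex_degree_commuting_graph[OF fin mem(1)])
  finally have "?L $$ (i, j) = ?F (vs ! i) (vs ! j)" by (cases "vs ! i = vs ! j") simp_all
  then show "?L $$ (i, j) = rel_mat ?F vs vs $$ (i, j)" using ij by (simp add: rel_mat_def)
qed (simp_all add: rel_mat_def laplacian_mat_def degree_mat_def adjacency_mat_def)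

section \<open>Normal forms and the word problem\<close>

definition sd_index :: "nat \<Rightarrow> (nat \<times> nat) set" where
  "sd_index n = {..<4 * n} \<times> {..<2}"

text \<open>The pair (i, j) is the coordinate of the element a^i b^j.\<close>

definition sd_elem :: "nat \<Rightarrow> nat \<times> nat \<Rightarrow> sd_gen word set" where
  "sd_elem n p = pres_class (sd_relations n) (sd_nf (fst p) (snd p))"

lemma bij_betw_sd_elem:
  assumes "n \<ge> 1"
  shows "bij_betw (sd_elem n) (sd_index n) (carrier (SD n))"
  unfolding bij_betw_def
proof
  show "inj_on (sd_elem n) (sd_index n)"
    using sd_nf_inj[OF assms] by (auto simp: inj_on_def sd_elem_def sd_index_def pres_class_eq_iff)
  have "pres_class (sd_relations n) w \<in> sd_elem n ` sd_index n" for w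
  proof -
    obtain i j where "i < 4 * n" "j < 2" "pres_eq (sd_relations n) w (sd_nf i j)"
      using sd_word_nf[OF assms] by blast
    then show ?thesis
      by (intro image_eqI[of _ _ "(i, j)"]) (auto simp: pres_class_eq_iff sd_elem_def sd_index_def)
  qed
  then show "sd_elem n ` sd_index n = carrier (SD n)"
    by (auto simp: SD_def presented_group_def sd_elem_def)
qed

text \<open>The rightmost letter acts first: a factor b multiplies the exponent by 2n - 1 and flips
  the flag, and a^i then shifts the exponent by i.\<close>

lemma sd_acts_nf:
  assumes "n \<ge> 1" "j < 2" "k \<in> {0..<4 * int n}"
  shows "sd_acts n (sd_nf i j) (k, t) =
    ((if j = 0 then k + int i else (2 * int n - 1) * k + int i) mod (4 * int n), t \<noteq> (j = 1))"
proof -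
  have "j = 0 \<or> j = 1" using assms(2) by auto
  then show ?thesis
    using assms sd_acts_replicate_a[of "(2 * int n - 1) * k mod (4 * int n)" n i]
    by (auto simp: sd_acts_replicate_a mod_add_left_eq simp del: foldr_replicate)
qed

text \<open>Distinct normal forms send (0, False) to distinct points, so equality in the group
  becomes arithmetic modulo 4n.\<close>

lemma pres_eq_sd_iff:
  assumes n: "n \<ge> 1"
  shows "pres_eq (sd_relations n) u v \<longleftrightarrow> sd_acts n u (0, False) = sd_acts n v (0, False)"
proof
  show "sd_acts n u (0, False) = sd_acts n v (0, False)" if "pres_eq (sd_relations n) u v"
    using sd_acts_cong[OF n that] n by auto
next
  assume acts: "sd_acts n u (0, False) = sd_acts n v (0, False)"
  obtain i j where u: "i < 4 * n" "j < 2" "pres_eq (sd_relations n) u (sd_nf i j)"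
    using sd_word_nf[OF n] by blast
  obtain k l where v: "k < 4 * n" "l < 2" "pres_eq (sd_relations n) v (sd_nf k l)"
    using sd_word_nf[OF n] by blast
  have "sd_acts n (sd_nf i j) (0, False) = sd_acts n (sd_nf k l) (0, False)"
    using acts sd_acts_cong[OF n u(3)] sd_acts_cong[OF n v(3)] n by auto
  then have "int i = int k \<and> (j = 1) = (l = 1)"
    using u v n by (subst (asm) (1 2) sd_acts_nf) (auto split: if_splits)
  then have "i = k" "j = l" using u v by auto
  then show "pres_eq (sd_relations n) u v"
    using u(3) v(3) by (metis pres_sym pres_trans)
qed

section \<open>Commutation as divisibility\<close>

text \<open>Here the parity of n enters: after cancelling 2, the factor n - 1 is coprime to n and,
  being odd, also to 2n.\<close>

lemma sd_twist_dvd: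
  fixes n d :: int
  assumes "even n"
  shows "4 * n dvd (2 * n - 2) * d \<longleftrightarrow> 2 * n dvd d"
proof -
  have "coprime n (n - 1)" using coprime_diff_one_left[of n] by (simp add: coprime_commute)
  moreover have "coprime 2 (n - 1)" using assms by simp
  ultimately have "coprime (2 * n) (n - 1)" by simp
  moreover have "4 * n dvd (2 * n - 2) * d \<longleftrightarrow> 2 * (2 * n) dvd 2 * ((n - 1) * d)"
    by (simp add: algebra_simps)
  ultimately show ?thesis
    by (simp only: dvd_mult_cancel_left coprime_dvd_mult_right_iff) simp
qed

definition sd_center :: "nat \<Rightarrow> (nat \<times> nat) set" where
  "sd_center n = {(0, 0), (2 * n, 0)}"

text \<open>The representative of the noncentral powers of a is a itself; that of a^i b and its
  partner with exponent shifted by 2n is the one with exponent below 2n.\<close>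

definition sd_rep :: "nat \<Rightarrow> nat \<times> nat \<Rightarrow> nat \<times> nat" where
  "sd_rep n p = (if snd p = 0 then (1, 0) else (fst p mod (2 * n), 1))"

text \<open>The two sides are the exponents of a in a^i a^k b and a^k b a^i. They differ by (2n - 2)
  i, whatever k is.\<close>

lemma sd_twist_central:
  fixes i k n :: nat
  assumes "even n" "i < 4 * n"
  shows "(int k + int i) mod (4 * int n) = ((2 * int n - 1) * int i + int k) mod (4 * int n)
    \<longleftrightarrow> i = 0 \<or> i = 2 * n"
proof -
  have "(int k + int i) mod (4 * int n) = ((2 * int n - 1) * int i + int k) mod (4 * int n)
    \<longleftrightarrow> 4 * int n dvd ((2 * int n - 1) * int i + int k) - (int k + int i)"
    by (metis mod_eq_dvd_iff)
  also have "\<dots> \<longleftrightarrow> 4 * int n dvd (2 * int n - 2) * int i"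
    by (simp add: algebra_simps)
  also have "\<dots> \<longleftrightarrow> 2 * int n dvd int i"
    using assms by (intro sd_twist_dvd) simp
  also have "\<dots> \<longleftrightarrow> 2 * n dvd i"
    using int_dvd_int_iff[of "2 * n" i] by simp
  also have "\<dots> \<longleftrightarrow> i = 0 \<or> i = 2 * n"
  proof
    assume "2 * n dvd i"
    then obtain c where c: "i = 2 * n * c" by blast
    with assms(2) have "2 * n * c < 2 * n * 2" by simp
    then have "c < 2" using mult_less_cancel1 by blast
    with c show "i = 0 \<or> i = 2 * n" by (auto simp: less_2_cases_iff)
  qed auto
  finally show ?thesis .
qed

text \<open>The two sides are the exponents of a^i b a^k b and a^k b a^i b, which differ by (2n -
  2)(i - k).\<close>

lemma sd_twist_cosets:
  fixes i k n :: nat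
  assumes "even n"
  shows "((2 * int n - 1) * int k + int i) mod (4 * int n)
      = ((2 * int n - 1) * int i + int k) mod (4 * int n)
    \<longleftrightarrow> i mod (2 * n) = k mod (2 * n)"
proof -
  have "((2 * int n - 1) * int k + int i) mod (4 * int n)
      = ((2 * int n - 1) * int i + int k) mod (4 * int n)
    \<longleftrightarrow> 4 * int n dvd ((2 * int n - 1) * int i + int k) - ((2 * int n - 1) * int k + int i)"
    by (metis mod_eq_dvd_iff)
  also have "\<dots> \<longleftrightarrow> 4 * int n dvd (2 * int n - 2) * (int i - int k)"
    by (simp add: algebra_simps)
  also have "\<dots> \<longleftrightarrow> 2 * int n dvd int i - int k"
    using assms by (intro sd_twist_dvd) simp
  also have "\<dots> \<longleftrightarrow> int i mod (2 * int n) = int k mod (2 * int n)"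
    by (simp add: mod_eq_dvd_iff)
  also have "\<dots> \<longleftrightarrow> int (i mod (2 * n)) = int (k mod (2 * n))"
    by (simp add: zmod_int)
  finally show ?thesis by simp
qed

lemma sd_elem_commute_iff:
  assumes n: "n \<ge> 1" "even n" and p: "p \<in> sd_index n" and q: "q \<in> sd_index n"
  shows "sd_elem n p \<otimes>\<^bsub>SD n\<^esub> sd_elem n q = sd_elem n q \<otimes>\<^bsub>SD n\<^esub> sd_elem n p \<longleftrightarrow>
    p \<in> sd_center n \<or> q \<in> sd_center n \<or> sd_rep n p = sd_rep n q"
proof -
  obtain i j k l where pq: "p = (i, j)" "q = (k, l)" by fastforce
  then have b: "i < 4 * n" "j < 2" "k < 4 * n" "l < 2" using p q by (auto simp: sd_index_def)
  have acts: "sd_acts n (sd_nf i j @ sd_nf k l) (0, False) =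
      ((if j = 0 then int k + int i else (2 * int n - 1) * int k + int i) mod (4 * int n),
        (l = 1) \<noteq> (j = 1))"
    if "i < 4 * n" "j < 2" "k < 4 * n" "l < 2" for i j k l
  proof -
    have "sd_acts n (sd_nf k l) (0, False) = (int k, l = 1)"
      using n that by (subst sd_acts_nf) auto
    then have "sd_acts n (sd_nf i j @ sd_nf k l) (0, False) = sd_acts n (sd_nf i j) (int k, l = 1)"
      by (simp only: foldr_append comp_apply)
    also have "\<dots> = ((if j = 0 then int k + int i else (2 * int n - 1) * int k + int i)
        mod (4 * int n), (l = 1) \<noteq> (j = 1))"
      using n that by (intro sd_acts_nf) auto
    finally show ?thesis .
  qed
  have "sd_elem n p \<otimes>\<^bsub>SD n\<^esub> sd_elem n q = sd_elem n q \<otimes>\<^bsub>SD n\<^esub> sd_elem n p \<longleftrightarrow>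
     sd_acts n (sd_nf i j @ sd_nf k l) (0, False) = sd_acts n (sd_nf k l @ sd_nf i j) (0, False)"
    unfolding pq sd_elem_def SD_def fst_conv snd_conv presented_group_mult pres_class_eq_iff
    by (rule pres_eq_sd_iff[OF n(1)])
  also have "\<dots> \<longleftrightarrow> p \<in> sd_center n \<or> q \<in> sd_center n \<or> sd_rep n p = sd_rep n q"
  proof -
    \<comment> \<open>Two powers of a always commute; the mixed cases reduce to centrality of the
      power of a, and two elements outside the powers of a to congruence of exponents modulo
      2n.\<close>
    consider "j = 0" "l = 0" | "j = 0" "l = 1" | "j = 1" "l = 0" | "j = 1" "l = 1"
      using b by linarith
    then show ?thesis
    proof cases
      case 1
      then show ?thesis
        unfolding acts[OF b] acts[OF b(3,4,1,2)] by (simp add: pq sd_rep_def add.commute)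
    next
      case 2
      then show ?thesis
        unfolding acts[OF b] acts[OF b(3,4,1,2)] using sd_twist_central[OF n(2) b(1), of k]
        by (simp add: pq sd_rep_def sd_center_def)
    next
      case 3
      then show ?thesis
        unfolding acts[OF b] acts[OF b(3,4,1,2)] using sd_twist_central[OF n(2) b(3), of i]
        by (simp add: pq sd_rep_def sd_center_def) metis
    next
      case 4
      then show ?thesis
        unfolding acts[OF b] acts[OF b(3,4,1,2)] using sd_twist_cosets[OF n(2), of k i]
        by (simp add: pq sd_rep_def sd_center_def)
    qed
  qed
  finally show ?thesis .
qed

section \<open>Clique sizes and transfer to coordinates\<close>

lemma card_blocks_sd:
  assumes n: "n \<ge> 2"
  shows "card (sd_index n) = 8 * n" and "card (sd_center n) = 2"
    and "card {w \<in> sd_index n - sd_center n. sd_rep n w = (1, 0)} = 4 * n - 2"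
    and "q < 2 * n \<Longrightarrow> card {w \<in> sd_index n - sd_center n. sd_rep n w = (q, 1)} = 2"
proof -
  show "card (sd_index n) = 8 * n" by (simp add: sd_index_def)
  show "card (sd_center n) = 2" using n by (simp add: sd_center_def)
  have "{w \<in> sd_index n - sd_center n. sd_rep n w = (1, 0)} = ({..<4 * n} - {0, 2 * n}) \<times> {0}"
    by (auto simp: sd_index_def sd_center_def sd_rep_def split: if_splits)
  moreover have "card ({..<4 * n} - {0, 2 * n}) = 4 * n - 2"
    using n by (subst card_Diff_subset) auto
  ultimately show "card {w \<in> sd_index n - sd_center n. sd_rep n w = (1, 0)} = 4 * n - 2"
    by (simp add: card_cartesian_product)
  assume q: "q < 2 * n"
  have "i < 4 * n \<and> i mod (2 * n) = q \<longleftrightarrow> i = q \<or> i = q + 2 * n" for i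
    using q by (cases "i < 2 * n") (auto simp: le_mod_geq)
  then have "{i. i < 4 * n \<and> i mod (2 * n) = q} = {q, q + 2 * n}" by blast
  moreover have "{w \<in> sd_index n - sd_center n. sd_rep n w = (q, 1)}
      = {i. i < 4 * n \<and> i mod (2 * n) = q} \<times> {1}"
    by (auto simp: sd_index_def sd_center_def sd_rep_def split: if_splits)
  ultimately have "{w \<in> sd_index n - sd_center n. sd_rep n w = (q, 1)} = {(q, 1), (q + 2 * n, 1)}"
    by simp
  then show "card {w \<in> sd_index n - sd_center n. sd_rep n w = (q, 1)} = 2"
    using n by simp
qed

text \<open>The choices are e for \<open>z0\<close> and a for \<open>r0\<close>, so the large clique
  is the one whose indicator is left out of the basis.\<close>

lemma joined_cliques_sd:
  assumes n: "n \<ge> 2"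
  shows "joined_cliques (sd_index n) (sd_center n) (sd_rep n) (0, 0) (1, 0)"
  using n
  by unfold_locales
    (auto simp: sd_index_def sd_center_def sd_rep_def intro: less_le_trans[OF mod_less_divisor])

text \<open>The bijection \<open>sd_elem\<close> carries closed neighbourhoods to centralizers, so
  the matrices agree entry by entry once \<open>vs\<close> is replaced by the image of
  \<open>ps\<close>.\<close>

lemma char_poly_laplacian_sd:
  assumes n: "n \<ge> 2" "even n" and vs: "distinct vs" "set vs = carrier (SD n)"
    and ps: "distinct ps" "set ps = sd_index n"
  shows "char_poly (laplacian_mat (commuting_graph (SD n)) vs) =
    char_poly (rel_mat (joined_cliques.lap (sd_index n) (sd_center n) (sd_rep n)) ps ps)"
proof -
  interpret joined_cliques "sd_index n" "sd_center n" "sd_rep n" "(0, 0)" "(1, 0)"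
    by (rule joined_cliques_sd[OF n(1)])
  let ?G = "SD n" and ?e = "sd_elem n"
  let ?C = "\<lambda>u. {w \<in> carrier ?G. u \<otimes>\<^bsub>?G\<^esub> w = w \<otimes>\<^bsub>?G\<^esub> u}"
  let ?F = "\<lambda>u v. of_bool (u = v) * real (card (?C u)) 
      - of_bool (u \<otimes>\<^bsub>?G\<^esub> v = v \<otimes>\<^bsub>?G\<^esub> u)"
  have n1: "n \<ge> 1" using n by simp
  have inj: "inj_on ?e (sd_index n)" and img: "?e ` sd_index n = carrier ?G"
    using bij_betw_sd_elem[OF n1] by (auto simp: bij_betw_def)
  have comm: "?e p \<otimes>\<^bsub>?G\<^esub> ?e q = ?e q \<otimes>\<^bsub>?G\<^esub> ?e p \<longleftrightarrow> q \<in> nbhd p"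
    if "p \<in> sd_index n" "q \<in> sd_index n" for p q
    using sd_elem_commute_iff[OF n1 n(2) that] that(2) by (simp add: nbhd_def)
  have card_C: "card (?C (?e p)) = card (nbhd p)" if "p \<in> sd_index n" for p
  proof -
    have "?C (?e p) = ?e ` nbhd p"
      using comm[OF that] unfolding img[symmetric] by (auto simp: nbhd_def)
    moreover have "nbhd p \<subseteq> sd_index n" by (auto simp: nbhd_def)
    ultimately show ?thesis using inj by (simp add: card_image inj_on_subset)
  qed
  have "char_poly (laplacian_mat (commuting_graph ?G) vs) = char_poly (rel_mat ?F vs vs)"
    using finite_SD[OF n1] vs by (subst laplacian_commuting_graph) auto
  also have "\<dots> = char_poly (rel_mat ?F (map ?e ps) (map ?e ps))"
    by (rule char_poly_rel_mat_enumeration) (use vs ps inj img in \<open>auto simp: distinct_map\<close>)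
  also have "rel_mat ?F (map ?e ps) (map ?e ps) = rel_mat (\<lambda>p q. ?F (?e p) (?e q)) ps ps"
    by (auto simp: rel_mat_def)
  also have "\<dots> = rel_mat lap ps ps"
    by (rule rel_mat_cong) (use ps inj in \<open>auto simp: lap_def comm card_C inj_on_eq_iff\<close>)
  finally show ?thesis .
qed

section \<open>Evaluation of the product over all vertices\<close>

theorem theorem4p18:
  fixes n :: nat and vs :: "sd_gen word set list"
  assumes "n \<ge> 2" and "even n"
    and "distinct vs" and "set vs = fst (commuting_graph (SD n))"
  shows "char_poly (laplacian_mat (commuting_graph (SD n)) vs) =
    [:0, 1:] * [:- real (8 * n), 1:] ^ 2 * [:- 4, 1:] ^ (2 * n) * [:- 2, 1:] ^ (2 * n)
      * [:- real (4 * n), 1:] ^ (4 * n - 3)"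
proof -
  note n = \<open>n \<ge> 2\<close>
  interpret joined_cliques "sd_index n" "sd_center n" "sd_rep n" "(0, 0)" "(1, 0)"
    by (rule joined_cliques_sd[OF n])
  define g where "g v = [:- (if v = (0, 0) then 0
       else if v \<in> sd_center n \<or> v = (1, 0) then real (card (sd_index n))
       else if sd_rep n v = v then real (card (sd_center n))
       else real (card (sd_center n) + card (block (sd_rep n v)))), 1:]" for v
  \<comment> \<open>The value 8n occurs at \<open>r0\<close>, where i = 1, and at the central
    element with i = 2n; the other noncentral powers give 2 + (4n - 2) = 4n.\<close>
  have g_a: "g (i, 0) = (if i = 0 then [:0, 1:] else if i = 1 \<or> i = 2 * n then [:- real (8 * n), 1:]
      else [:- real (4 * n), 1:])" for i
  proof -
    have "card (block (1, 0)) = 4 * n - 2" using card_blocks_sd(3)[OF n] by (simp only: block_def)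
    moreover have "(i, 0) \<in> sd_center n \<longleftrightarrow> i = 0 \<or> i = 2 * n" by (simp add: sd_center_def)
    moreover have "sd_rep n (i, 0) = (1, 0)" by (simp add: sd_rep_def)
    ultimately show ?thesis using n by (simp add: g_def card_blocks_sd[OF n])
  qed
  \<comment> \<open>Exponents below 2n are the representatives and give |Z| = 2; their partners give
    2 + 2 = 4.\<close>
  have g_b: "g (i, 1) = (if i < 2 * n then [:- 2, 1:] else [:- 4, 1:])" for i
  proof -
    have "card (block (i mod (2 * n), 1)) = 2"
      using card_blocks_sd(4)[OF n] n by (simp only: block_def) simp
    moreover have "(i, 1) \<notin> sd_center n" by (simp add: sd_center_def)
    moreover have "sd_rep n (i, 1) = (i mod (2 * n), 1)" by (simp add: sd_rep_def)
    moreover have "i mod (2 * n) = i \<longleftrightarrow> i < 2 * n"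
      using n by (simp add: mod_eq_self_iff_div_eq_0 div_eq_0_iff)
    ultimately show ?thesis by (simp add: g_def card_blocks_sd[OF n])
  qed
  obtain ps where ps: "distinct ps" "set ps = sd_index n"
    using finite_distinct_list[OF finite_V] by blast
  have "set vs = carrier (SD n)" using assms by (simp add: commuting_graph_def)
  then have "char_poly (laplacian_mat (commuting_graph (SD n)) vs) = prod g (sd_index n)"
    using char_poly_laplacian_sd[OF n] assms ps char_poly_lap[OF ps] unfolding g_def by simp
  also have "\<dots> = (\<Prod>i<4 * n. g (i, 0)) * (\<Prod>i<4 * n. g (i, 1))"
    unfolding sd_index_def prod.cartesian_product[symmetric, of "\<lambda>i j. g (i, j)", simplified]
    by (simp add: numeral_2_eq_2 lessThan_Suc prod.distrib mult.commute)
  also have "(\<Prod>i<4 * n. g (i, 0)) =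
      [:0, 1:] * [:- real (8 * n), 1:] ^ 2 * [:- real (4 * n), 1:] ^ (4 * n - 3)"
  proof -
    \<comment> \<open>The exponents 0, 1 and 2n are distinct and carry the factors other than 4n,
      which leaves 4n - 3 exponents.\<close>
    let ?R = "{..<4 * n} - {0, 1, 2 * n}"
    have "{..<4 * n} = insert 0 (insert 1 (insert (2 * n) ?R))" using n by auto
    then have "(\<Prod>i<4 * n. g (i, 0)) = (\<Prod>i\<in>insert 0 (insert 1 (insert (2 * n) ?R)). g (i, 0))"
      by simp
    also have "\<dots> = g (0, 0) * (g (1, 0) * (g (2 * n, 0) * (\<Prod>i\<in>?R. g (i, 0))))"
      using n by (subst prod.insert, simp, simp)+ simp
    also have "(\<Prod>i\<in>?R. g (i, 0)) = (\<Prod>i\<in>?R. [:- real (4 * n), 1:])"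
      by (intro prod.cong) (auto simp: g_a)
    also have "\<dots> = [:- real (4 * n), 1:] ^ card ?R" by simp
    also have "card ?R = 4 * n - 3"
      using n by (subst card_Diff_subset) auto
    also have "g (0, 0) = [:0, 1:]" by (simp add: g_a)
    also have "g (1, 0) = [:- real (8 * n), 1:]" by (simp add: g_a)
    also have "g (2 * n, 0) = [:- real (8 * n), 1:]" using n by (simp add: g_a)
    finally show ?thesis by (simp only: power2_eq_square mult.assoc)
  qed
  also have "(\<Prod>i<4 * n. g (i, 1)) = [:- 2, 1:] ^ (2 * n) * [:- 4, 1:] ^ (2 * n)"
  proof -
    have "(\<Prod>i<4 * n. g (i, 1)) = (\<Prod>i<4 * n. if i < 2 * n then [:- 2, 1:] else [:- 4, 1:])"
      by (simp only: g_b)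
    also have "\<dots> = [:- 2, 1:] ^ card ({..<4 * n} \<inter> {i. i < 2 * n})
        * [:- 4, 1:] ^ card ({..<4 * n} \<inter> - {i. i < 2 * n})"
      by (simp add: prod.If_cases)
    also have "{..<4 * n} \<inter> {i. i < 2 * n} = {..<2 * n}" by auto
    also have "{..<4 * n} \<inter> - {i. i < 2 * n} = {2 * n..<4 * n}" by auto
    finally show ?thesis by simp
  qed
  finally show ?thesis by (simp only: ac_simps)
qed

end
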